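(* Let $f = \sum_{S \subseteq [n]} c_S x^S \in \mathbb{C}\{\!\{t\}\!\}[x_1,\dots,x_n]$ be a multiaffine stable polynomial over the field of Puiseux series, and define $\nu: 2^{[n]} \to \mathbb{R} \cup \{\infty\}$ by $\nu(S) = \operatorname{val}(c_S)$. Then $\nu$ is a valuated $\Delta$-matroid.
   Context: Notation: $[n]=\{1,\dots,n\}$; for $S\subseteq[n]$, $x^S=\prod_{i\in S}x_i$ and $e_S\in\{0,1\}^n$ is the indicator vector of $S$, and $2^{[n]}$ is identified with $\{0,1\}^n$ via $S\mapsto e_S$; $X\Delta Y$ denotes symmetric difference. A polynomial is multiaffine if it has degree at most one in each variable. Puiseux series: $\mathbb{C}\{\!\{t\}\!\}=\bigcup_{N\ge1}\mathbb{C}((t^{1/N}))$ and $\mathbb{R}\{\!\{t\}\!\}=\bigcup_{N\ge1}\mathbb{R}((t^{1/N}))$. The valuation $\operatorname{val}(c)$ of $c\ne0$ is the smallest exponent of $t$ with nonzero coefficient in $c$, and $\operatorname{val}(0)=\infty$. The field $\mathbb{R}\{\!\{t\}\!\}$ is a real closed ordered field in which a nonzero element is positive iff the coefficient of its lowest-order term is positive. Every $z\in\mathbb{C}\{\!\{t\}\!\}$ is uniquely $z=a+ib$ with $a,b\in\mathbb{R}\{\!\{t\}\!\}$, and $\operatorname{Im}(z)=b$. A polynomial $f\in\mathbb{C}\{\!\{t\}\!\}[x_1,\dots,x_n]$ is stable if $f(z_1,\dots,z_n)\neq0$ for all $z_1,\dots,z_n\in\mathbb{C}\{\!\{t\}\!\}$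 with $\operatorname{Im}(z_1),\dots,\operatorname{Im}(z_n)>0$. A $\Delta$-matroid is a nonempty collection $\mathcal{B}\subseteq 2^{[n]}$ such that for any $X,Y\in\mathcal{B}$ and any $i\in X\Delta Y$ there exists $j\in X\Delta Y$ (possibly $j=i$) with $X\Delta\{i,j\}\in\mathcal{B}$. A $\Delta$-matroid polytope is a polytope of the form $\operatorname{conv}\{e_B: B\in\mathcal{B}\}$ with $\mathcal{B}$ a $\Delta$-matroid. Given $p:\{0,1\}^n\to\mathbb{R}\cup\{\infty\}$, not identically $\infty$, the regular subdivision induced by $p$ is the polyhedral subdivision of $\operatorname{conv}\{e_S : p(e_S)<\infty\}$ whose cells are the polytopes $\operatorname{conv}\{e_S : S\in M_w\}$ for $w\in\mathbb{R}^n$, where $M_w$ is the set of $S\subseteq[n]$ attaining $\min_{S\subseteq[n]}\big(\langle w,e_S\rangle+p(e_S)\big)$. The function $p$ is a valuated $\Delta$-matroid if every cell of its induced regular subdivision is a $\Delta$-matroid polytope; equivalently, if every edge (one-dimensional cell) of the induced subdivision has $\ell_1$-length at most two. *)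

theory Defs
  imports
    "HOL-Analysis.Analysis"
    "HOL-Computational_Algebra.Formal_Laurent_Series"
    "HOL-Library.Poly_Mapping"
begin

section \<open>Puiseux series\<close>

text \<open>
  \<open>ramify N f\<close> is the coefficient function of \<open>f(t\<^bsup>1/N\<^esup>)\<close>, indexed by the rational
  exponents of \<open>t\<close>.  A Puiseux series is identified with its coefficient function.
\<close>

definition ramify :: "nat \<Rightarrow> 'a::zero fls \<Rightarrow> rat \<Rightarrow> 'a" where
  "ramify N f = (\<lambda>q. if of_nat N * q \<in> \<int> then fls_nth f \<lfloor>of_nat N * q\<rfloor> else 0)"

typedef (overloaded) 'a puiseux = "{c :: rat \<Rightarrow> 'a::zero. \<exists>N\<ge>1. \<exists>f. c = ramify N f}"
  morphisms pcoeff Abs_puiseux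
  by blast

setup_lifting type_definition_puiseux

lemma puiseux_eqI: "(\<And>q. pcoeff x q = pcoeff y q) \<Longrightarrow> x = y"
  by (simp add: pcoeff_inject[symmetric] fun_eq_iff)

lemma ramify_nth: "N \<ge> 1 \<Longrightarrow> ramify N f (of_int k / of_nat N) = fls_nth f k"
  by (simp add: ramify_def)

lemma ramify_cases:
  assumes "N \<ge> 1"
  obtains k where "(q::rat) = of_int k / of_nat N" | "of_nat N * q \<notin> \<int>"
proof (cases "of_nat N * q \<in> \<int>")
  case True
  then obtain k where "of_nat N * q = of_int k" by (auto elim: Ints_cases)
  then have "q = of_int k / of_nat N" using assms by (simp add: field_simps)
  then show ?thesis by (rule that(1))
qed (rule that(2))

lemma ramify_eqI:
  assumes "N \<ge> 1" "\<And>k. c (of_int k / of_nat N) = fls_nth f k"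
    "\<And>q. of_nat N * q \<notin> \<int> \<Longrightarrow> c q = 0"
  shows "c = ramify N f"
proof
  fix q show "c q = ramify N f q"
    by (rule ramify_cases[OF assms(1), of q])
      (simp_all only: assms(2,3) ramify_nth[OF assms(1)], simp add: ramify_def assms(3))
qed

lemma ramify_inject: "N \<ge> 1 \<Longrightarrow> ramify N f = ramify N g \<longleftrightarrow> f = g"
  by (metis ramify_nth fls_eqI)

lemma ramify_refine:
  assumes "N \<ge> 1" "M \<ge> 1"
  shows "ramify N f = ramify (N * M) (fls_compose_power f M)"
proof (rule ramify_eqI)
  show "N * M \<ge> 1" using assms by simp
  fix k :: int
  have *: "of_nat N * (of_int k / of_nat (N * M)) = (of_int k / of_nat M :: rat)"
    using assms by (simp add: field_simps)
  show "ramify N f (of_int k / of_nat (N * M)) = fls_nth (fls_compose_power f M) k"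
  proof (cases "int M dvd k")
    case True
    then obtain j where j: "k = int M * j" by auto
    then have "of_int k / of_nat M = (of_int j :: rat)" using assms by simp
    then show ?thesis using assms j unfolding ramify_def *
      by (simp add: fls_nth_compose_power)
  next
    case False
    have "of_int k / of_nat M \<notin> (\<int> :: rat set)"
    proof
      assume "of_int k / of_nat M \<in> (\<int> :: rat set)"
      then obtain j where "of_int k / of_nat M = (of_int j :: rat)" by (auto elim: Ints_cases)
      then have "(of_int k :: rat) = of_int (int M * j)" using assms by (simp add: field_simps)
      then have "k = int M * j" by (simp only: of_int_eq_iff)
      then show False using False by simp
    qed
    then show ?thesis using False assms unfolding ramify_def * by (simp add: fls_nth_compose_power)
  qed
next
  fix q :: rat
  assume *: "of_nat (N * M) * q \<notin> \<int>"
  have "of_nat N * q \<notin> \<int>"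
  proof
    assume "of_nat N * q \<in> \<int>"
    then have "of_nat M * (of_nat N * q) \<in> \<int>" by (rule Ints_mult[OF Ints_of_nat])
    then have "of_nat (N * M) * q \<in> \<int>" by (simp only: of_nat_mult mult_ac)
    then show False using * by blast
  qed
  then show "ramify N f q = 0" by (simp add: ramify_def)
qed

lemma ramify_common2:
  assumes "N \<ge> 1" "M \<ge> 1"
  shows "\<exists>K\<ge>1. \<exists>f' g'. ramify N f = ramify K f' \<and> ramify M g = ramify K g'"
proof (intro exI conjI)
  show "N * M \<ge> 1" using assms by simp
  show "ramify N f = ramify (N * M) (fls_compose_power f M)" by (rule ramify_refine[OF assms])
  show "ramify M g = ramify (N * M) (fls_compose_power g N)"
    using ramify_refine[OF assms(2,1), of g] by (simp only: mult.commute)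
qed

text \<open>The Cauchy product of coefficient functions.  For Puiseux series the index set is finite, so
  the convention that infinite sums are \<open>0\<close> is never used.\<close>

definition cauchy_prod :: "(rat \<Rightarrow> 'a::semiring_0) \<Rightarrow> (rat \<Rightarrow> 'a) \<Rightarrow> rat \<Rightarrow> 'a" where
  "cauchy_prod c d = (\<lambda>q. \<Sum>r | c r \<noteq> 0 \<and> d (q - r) \<noteq> 0. c r * d (q - r))"

lemma cauchy_prod_ramify:
  assumes N: "N \<ge> 1"
  shows "cauchy_prod (ramify N f) (ramify N g) = ramify N (f * g)"
proof (rule ramify_eqI[OF N])
  fix k :: int
  let ?e = "\<lambda>i::int. of_int i / of_nat N :: rat"
  let ?I = "{fls_subdegree f..k - fls_subdegree g}"
  let ?S = "{r. ramify N f r \<noteq> 0 \<and> ramify N g (?e k - r) \<noteq> 0}"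
  have inj: "inj_on ?e A" for A using N by (auto simp: inj_on_def)
  have e: "?e k - ?e i = ?e (k - i)" for i by (simp add: diff_divide_distrib)
  have sub: "?S \<subseteq> ?e ` ?I"
  proof
    fix r assume r: "r \<in> ?S"
    show "r \<in> ?e ` ?I"
    proof (rule ramify_cases[OF N, of r])
      fix i assume i: "r = ?e i"
      then have "fls_nth f i \<noteq> 0" "fls_nth g (k - i) \<noteq> 0"
        using r N by (simp_all only: mem_Collect_eq e ramify_nth[OF N] not_False_eq_True)
      then have "i \<in> ?I" by (force dest: fls_subdegree_leI)
      then show ?thesis using i by blast
    next
      assume "of_nat N * r \<notin> \<int>"
      then show ?thesis using r by (simp add: ramify_def)
    qed
  qed
  have "cauchy_prod (ramify N f) (ramify N g) (?e k) = (\<Sum>r\<in>?e ` ?I. ramify N f r * ramify N g (?e k - r))"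
    unfolding cauchy_prod_def using sub by (intro sum.mono_neutral_left) auto
  also have "\<dots> = (\<Sum>i\<in>?I. fls_nth f i * fls_nth g (k - i))"
    by (subst sum.reindex[OF inj]) (simp only: o_def ramify_nth[OF N] e)
  also have "\<dots> = fls_nth (f * g) k" by (simp add: fls_times_nth(2))
  finally show "cauchy_prod (ramify N f) (ramify N g) (?e k) = fls_nth (f * g) k" .
next
  fix q :: rat assume q: "of_nat N * q \<notin> \<int>"
  have "ramify N f r = 0 \<or> ramify N g (q - r) = 0" for r
  proof (rule ccontr)
    assume "\<not> ?thesis"
    then have "of_nat N * r \<in> \<int>" "of_nat N * (q - r) \<in> \<int>"
      by (auto simp: ramify_def split: if_splits)
    then have "of_nat N * r + of_nat N * (q - r) \<in> \<int>" by (rule Ints_add)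
    then show False using q by (simp add: algebra_simps)
  qed
  then show "cauchy_prod (ramify N f) (ramify N g) q = 0" by (auto simp: cauchy_prod_def intro: sum.neutral)
qed

lemma ramify_pointwise2:
  fixes h :: "'a::zero \<Rightarrow> 'b::zero \<Rightarrow> 'c::zero"
  assumes "h 0 0 = 0" "N \<ge> 1"
  shows "(\<lambda>q. h (ramify N f q) (ramify N g q)) = ramify N (Abs_fls (\<lambda>k. h (fls_nth f k) (fls_nth g k)))"
proof -
  obtain A where A: "\<forall>n<A. fls_nth f n = 0" by (rule fls_nth_vanishes_belowE)
  obtain B where B: "\<forall>n<B. fls_nth g n = 0" by (rule fls_nth_vanishes_belowE)
  have "fls_nth (Abs_fls (\<lambda>k. h (fls_nth f k) (fls_nth g k))) k = h (fls_nth f k) (fls_nth g k)" for k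
    by (rule nth_Abs_fls_lower_bound[of "min A B"]) (use A B assms in auto)
  then show ?thesis
    by (intro ramify_eqI[OF assms(2)]) (simp_all only: ramify_nth[OF assms(2)], simp add: assms(1) ramify_def)
qed

lemma ramify_ex_pointwise2:
  assumes "h 0 0 = 0" "\<exists>N\<ge>1. \<exists>f. c = ramify N f" "\<exists>N\<ge>1. \<exists>f. d = ramify N f"
  shows "\<exists>N\<ge>1. \<exists>f. (\<lambda>q. h (c q) (d q)) = ramify N f"
proof -
  obtain N f M g where *: "N \<ge> 1" "M \<ge> 1" "c = ramify N f" "d = ramify M g"
    using assms(2,3) by blast
  obtain K f' g' where **: "K \<ge> 1" "c = ramify K f'" "d = ramify K g'"
    using ramify_common2[OF *(1,2), of f g] * by auto
  show ?thesis using ramify_pointwise2[of h, OF assms(1) **(1), of f' g'] ** by blast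
qed

lemma ramify_ex_pointwise:
  assumes "h 0 = 0" "\<exists>N\<ge>1. \<exists>f. c = ramify N f"
  shows "\<exists>N\<ge>1. \<exists>f. (\<lambda>q. h (c q)) = ramify N f"
  using ramify_ex_pointwise2[of "\<lambda>x _. h x" c c] assms by blast


subsection \<open>Field operations\<close>

instantiation puiseux :: (zero) zero
begin
lift_definition zero_puiseux :: "'a puiseux" is "\<lambda>_. 0"
  by (rule exI[of _ 1], simp, rule exI[of _ 0]) (simp add: ramify_def fun_eq_iff)
instance ..
end

text \<open>\<open>puiseux_of N f\<close> is \<open>f(t\<^bsup>1/N\<^esup>)\<close>, for \<open>N \<ge> 1\<close>.\<close>

lift_definition puiseux_of :: "nat \<Rightarrow> 'a::zero fls \<Rightarrow> 'a puiseux" is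
  "\<lambda>N f. if N \<ge> 1 then ramify N f else (\<lambda>_. 0)"
  subgoal for N f
    using zero_puiseux.rep_eq[where 'a = 'a] pcoeff[of "0 :: 'a puiseux"] by auto
  done

lemma pcoeff_puiseux_of: "N \<ge> 1 \<Longrightarrow> pcoeff (puiseux_of N f) = ramify N f"
  by (simp add: puiseux_of.rep_eq)

lemma puiseux_of_inject: "N \<ge> 1 \<Longrightarrow> puiseux_of N f = puiseux_of N g \<longleftrightarrow> f = g"
  by (metis pcoeff_puiseux_of ramify_inject)

lemma puiseux_ex1: "\<exists>N\<ge>1. \<exists>f. x = puiseux_of N f"
  by transfer auto

lemma puiseux_of_refine:
  "N \<ge> 1 \<Longrightarrow> M \<ge> 1 \<Longrightarrow> puiseux_of N f = puiseux_of (N * M) (fls_compose_power f M)"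
  by (intro puiseux_eqI) (simp add: pcoeff_puiseux_of ramify_refine[symmetric])

lemma puiseux_ex2: "\<exists>N\<ge>1. \<exists>f g. x = puiseux_of N f \<and> y = puiseux_of N g"
proof -
  obtain N f M g where *: "N \<ge> 1" "M \<ge> 1" "x = puiseux_of N f" "y = puiseux_of M g"
    using puiseux_ex1 by metis
  then have "N * M \<ge> 1" "x = puiseux_of (N * M) (fls_compose_power f M)"
    "y = puiseux_of (N * M) (fls_compose_power g N)"
    using puiseux_of_refine[of N M f] puiseux_of_refine[of M N g] by (simp_all add: mult.commute)
  then show ?thesis by blast
qed

lemma puiseux_ex3:
  "\<exists>N\<ge>1. \<exists>f g h. x = puiseux_of N f \<and> y = puiseux_of N g \<and> z = puiseux_of N h"
proof -
  obtain N f g where *: "N \<ge> 1" "x = puiseux_of N f" "y = puiseux_of N g"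
    using puiseux_ex2 by metis
  obtain M h where **: "M \<ge> 1" "z = puiseux_of M h"
    using puiseux_ex1 by metis
  have "N * M \<ge> 1" "x = puiseux_of (N * M) (fls_compose_power f M)"
    "y = puiseux_of (N * M) (fls_compose_power g M)"
    "z = puiseux_of (N * M) (fls_compose_power h N)"
    using * ** puiseux_of_refine[of N M f] puiseux_of_refine[of N M g] puiseux_of_refine[of M N h]
    by (simp_all add: mult.commute)
  then show ?thesis by blast
qed

lemma puiseux_of_0: "puiseux_of N 0 = 0"
  by transfer (auto simp: ramify_def)

instantiation puiseux :: (comm_ring_1) comm_ring_1
begin

lift_definition one_puiseux :: "'a puiseux" is "\<lambda>q. if q = 0 then 1 else 0"
  by (rule exI[of _ 1], simp, rule exI[of _ 1])
    (auto simp: ramify_def fun_eq_iff elim: Ints_cases)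

lift_definition plus_puiseux :: "'a puiseux \<Rightarrow> 'a puiseux \<Rightarrow> 'a puiseux" is
  "\<lambda>c d q. c q + d q"
  by (rule ramify_ex_pointwise2) auto

lift_definition minus_puiseux :: "'a puiseux \<Rightarrow> 'a puiseux \<Rightarrow> 'a puiseux" is
  "\<lambda>c d q. c q - d q"
  by (rule ramify_ex_pointwise2) auto

lift_definition uminus_puiseux :: "'a puiseux \<Rightarrow> 'a puiseux" is "\<lambda>c q. - c q"
  by (rule ramify_ex_pointwise) auto

lift_definition times_puiseux :: "'a puiseux \<Rightarrow> 'a puiseux \<Rightarrow> 'a puiseux" is cauchy_prod
  subgoal premises prems for c d
  proof -
    obtain N f M g where *: "N \<ge> 1" "M \<ge> 1" "c = ramify N f" "d = ramify M g"
      using prems by blast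
    obtain K f' g' where **: "K \<ge> 1" "c = ramify K f'" "d = ramify K g'"
      using ramify_common2[OF *(1,2), of f g] * by auto
    show ?thesis using cauchy_prod_ramify[OF **(1), of f' g'] ** by metis
  qed
  done

lemma puiseux_of_add: "puiseux_of N (f + g) = puiseux_of N f + puiseux_of N (g :: 'a fls)"
  by transfer (auto simp: ramify_def)

lemma puiseux_of_diff: "puiseux_of N (f - g) = puiseux_of N f - puiseux_of N (g :: 'a fls)"
  by transfer (auto simp: ramify_def)

lemma puiseux_of_uminus: "puiseux_of N (- f) = - puiseux_of N (f :: 'a fls)"
  by transfer (auto simp: ramify_def)

lemma puiseux_of_mult: "puiseux_of N (f * g) = puiseux_of N f * puiseux_of N (g :: 'a fls)"
  by transfer (auto simp: cauchy_prod_ramify, simp add: cauchy_prod_def)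

lemma puiseux_of_1: "N \<ge> 1 \<Longrightarrow> puiseux_of N (1 :: 'a fls) = 1"
  by transfer (auto simp: ramify_def fun_eq_iff elim!: Ints_cases)

instance
proof
  fix a b c :: "'a puiseux"
  obtain N f g h where *: "N \<ge> 1" "a = puiseux_of N f" "b = puiseux_of N g" "c = puiseux_of N h"
    using puiseux_ex3 by metis
  note hom = puiseux_of_add[symmetric] puiseux_of_diff[symmetric] puiseux_of_uminus[symmetric]
    puiseux_of_mult[symmetric] puiseux_of_0[of N, symmetric] puiseux_of_1[OF *(1), symmetric]
    puiseux_of_inject[OF *(1)]
  show "a * b * c = a * (b * c)" "a * b = b * a" "1 * a = a" "a + b + c = a + (b + c)"
    "a + b = b + a" "0 + a = a" "- a + a = 0" "a - b = a + - b" "(a + b) * c = a * c + b * c"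
    unfolding * hom by (simp_all add: algebra_simps)
  show "0 \<noteq> (1 :: 'a puiseux)"
    unfolding hom by simp
qed

end

instantiation puiseux :: (field) field
begin

definition inverse_puiseux :: "'a puiseux \<Rightarrow> 'a puiseux" where
  "inverse_puiseux x = (if x = 0 then 0 else (THE y. x * y = 1))"

definition divide_puiseux :: "'a puiseux \<Rightarrow> 'a puiseux \<Rightarrow> 'a puiseux" where
  "divide_puiseux x y = x * inverse y"

instance
proof
  fix x y :: "'a puiseux"
  show "inverse x * x = 1" if "x \<noteq> 0"
  proof -
    obtain N f where *: "N \<ge> 1" "x = puiseux_of N f" using puiseux_ex1 by metis
    then have "f \<noteq> 0" using that puiseux_of_0 by metis
    then have "x * puiseux_of N (inverse f) = 1"
      using * by (simp add: puiseux_of_mult[symmetric] puiseux_of_1)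
    moreover have "y = z" if "x * y = 1" "x * z = 1" for y z
      using that by (metis mult.assoc mult.commute mult.right_neutral)
    ultimately have "\<exists>!y. x * y = 1" by blast
    from theI'[OF this] show ?thesis
      using that by (simp add: inverse_puiseux_def mult.commute)
  qed
  show "x div y = x * inverse y" by (simp add: divide_puiseux_def)
  show "inverse (0 :: 'a puiseux) = 0" by (simp add: inverse_puiseux_def)
qed

end


subsection \<open>Valuation\<close>

definition lead_exp :: "'a::zero puiseux \<Rightarrow> rat" where
  "lead_exp x = (LEAST q. pcoeff x q \<noteq> 0)"

definition puiseux_val :: "'a::zero puiseux \<Rightarrow> ereal" where
  "puiseux_val x = (if x = 0 then \<infinity> else ereal (of_rat (lead_exp x)))"

lemma lead_exp_puiseux_of:
  assumes "N \<ge> 1" "f \<noteq> 0"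
  shows "lead_exp (puiseux_of N f) = of_int (fls_subdegree f) / of_nat N"
  unfolding lead_exp_def
proof (rule Least_equality)
  show "pcoeff (puiseux_of N f) (of_int (fls_subdegree f) / of_nat N) \<noteq> 0"
    using assms by (simp add: pcoeff_puiseux_of ramify_nth)
  fix q assume "pcoeff (puiseux_of N f) q \<noteq> 0"
  then have q: "ramify N f q \<noteq> 0" using assms by (simp add: pcoeff_puiseux_of)
  show "of_int (fls_subdegree f) / of_nat N \<le> q"
  proof (rule ramify_cases[OF assms(1), of q])
    fix k assume k: "q = of_int k / of_nat N"
    then have "fls_nth f k \<noteq> 0" using q assms by (simp add: ramify_nth)
    then have "fls_subdegree f \<le> k" by (rule fls_subdegree_leI)
    then show ?thesis using k by (simp add: divide_right_mono)
  next
    assume "of_nat N * q \<notin> \<int>"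
    then show ?thesis using q by (simp add: ramify_def)
  qed
qed

lemma lead_coeff_puiseux_of:
  assumes "N \<ge> 1" "f \<noteq> 0"
  shows "pcoeff (puiseux_of N f) (lead_exp (puiseux_of N f)) = fls_nth f (fls_subdegree f)"
  by (simp only: lead_exp_puiseux_of[OF assms] pcoeff_puiseux_of[OF assms(1)] ramify_nth[OF assms(1)])


subsection \<open>The ordering\<close>

text \<open>A nonzero series is positive iff its lowest-order coefficient is positive.\<close>

definition puiseux_pos :: "'a::{zero,ord} puiseux \<Rightarrow> bool" where
  "puiseux_pos x \<longleftrightarrow> x \<noteq> 0 \<and> pcoeff x (lead_exp x) > 0"

lemma puiseux_pos_puiseux_of:
  assumes "N \<ge> 1"
  shows "puiseux_pos (puiseux_of N f) \<longleftrightarrow> f \<noteq> 0 \<and> fls_nth f (fls_subdegree f) > 0"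
  using assms lead_coeff_puiseux_of[of N f] puiseux_of_inject[of N f 0]
  by (auto simp: puiseux_pos_def puiseux_of_0)

lemma puiseux_pos_add:
  fixes x y :: "'a::linordered_field puiseux"
  assumes "puiseux_pos x" "puiseux_pos y"
  shows "puiseux_pos (x + y)"
proof -
  obtain N f g where *: "N \<ge> 1" "x = puiseux_of N f" "y = puiseux_of N g"
    using puiseux_ex2 by metis
  have f: "f \<noteq> 0" "fls_nth f (fls_subdegree f) > 0" and g: "g \<noteq> 0" "fls_nth g (fls_subdegree g) > 0"
    using assms * by (auto simp: puiseux_pos_puiseux_of)
  let ?m = "min (fls_subdegree f) (fls_subdegree g)"
  have pos: "fls_nth (f + g) ?m > 0"
    using f g by (cases "fls_subdegree f" "fls_subdegree g" rule: linorder_cases) (auto simp: add_pos_pos)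
  have "fls_subdegree (f + g) = ?m"
    using pos by (intro fls_subdegree_eqI) auto
  moreover have "f + g \<noteq> 0" using pos by (metis fls_zero_nth less_irrefl)
  ultimately show ?thesis using pos * by (simp add: puiseux_of_add[symmetric] puiseux_pos_puiseux_of)
qed

lemma puiseux_pos_mult:
  fixes x y :: "'a::linordered_field puiseux"
  assumes "puiseux_pos x" "puiseux_pos y"
  shows "puiseux_pos (x * y)"
proof -
  obtain N f g where *: "N \<ge> 1" "x = puiseux_of N f" "y = puiseux_of N g"
    using puiseux_ex2 by metis
  then show ?thesis using assms
    by (auto simp: puiseux_of_mult[symmetric] puiseux_pos_puiseux_of fls_times_base)
qed

lemma puiseux_pos_cases:
  fixes x :: "'a::linordered_field puiseux"
  shows "x = 0 \<or> puiseux_pos x \<or> puiseux_pos (- x)"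
proof -
  obtain N f where *: "N \<ge> 1" "x = puiseux_of N f" using puiseux_ex1 by metis
  show ?thesis
  proof (cases "f = 0")
    case False
    then have "fls_nth f (fls_subdegree f) > 0 \<or> fls_nth f (fls_subdegree f) < 0"
      by (metis linorder_less_linear nth_fls_subdegree_nonzero)
    then show ?thesis using False *
      by (auto simp: puiseux_of_uminus[symmetric] puiseux_pos_puiseux_of)
  qed (simp add: * puiseux_of_0)
qed

lemma not_puiseux_pos_0: "\<not> puiseux_pos 0"
  by (simp add: puiseux_pos_def)

instantiation puiseux :: (linordered_field) linordered_field
begin

definition less_puiseux :: "'a puiseux \<Rightarrow> 'a puiseux \<Rightarrow> bool" where
  "less_puiseux x y \<longleftrightarrow> puiseux_pos (y - x)"

definition less_eq_puiseux :: "'a puiseux \<Rightarrow> 'a puiseux \<Rightarrow> bool" where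
  "less_eq_puiseux x y \<longleftrightarrow> x = y \<or> x < y"

definition abs_puiseux :: "'a puiseux \<Rightarrow> 'a puiseux" where
  "abs_puiseux x = (if x < 0 then - x else x)"

definition sgn_puiseux :: "'a puiseux \<Rightarrow> 'a puiseux" where
  "sgn_puiseux x = (if x = 0 then 0 else if 0 < x then 1 else - 1)"

instance
proof
  fix x y z :: "'a puiseux"
  have trans: "u < w" if "u < v" "v < w" for u v w :: "'a puiseux"
    using puiseux_pos_add[of "v - u" "w - v"] that by (simp add: less_puiseux_def)
  have irr': "\<not> u < u" for u :: "'a puiseux" by (simp add: less_puiseux_def not_puiseux_pos_0)
  show "x < y \<longleftrightarrow> x \<le> y \<and> \<not> y \<le> x"
    using trans[of x y x] irr'[of x] by (auto simp: less_eq_puiseux_def)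
  show "x \<le> x" by (simp add: less_eq_puiseux_def)
  show "x \<le> z" if "x \<le> y" "y \<le> z" using that trans[of x y z] by (auto simp: less_eq_puiseux_def)
  show "x = y" if "x \<le> y" "y \<le> x" using that trans[of x y x] irr'[of x] by (auto simp: less_eq_puiseux_def)
  show "x \<le> y \<or> y \<le> x"
    using puiseux_pos_cases[of "y - x"] by (auto simp: less_eq_puiseux_def less_puiseux_def)
  show "z + x \<le> z + y" if "x \<le> y" using that by (auto simp: less_eq_puiseux_def less_puiseux_def)
  show "z * x < z * y" if "x < y" "0 < z"
    using that puiseux_pos_mult[of z "y - x"] by (simp add: less_puiseux_def right_diff_distrib)
  show "\<bar>x\<bar> = (if x < 0 then - x else x)" by (simp add: abs_puiseux_def)
  show "sgn x = (if x = 0 then 0 else if 0 < x then 1 else - 1)" by (simp add: sgn_puiseux_def)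
qed

end

lemma puiseux_pos_iff: "puiseux_pos x \<longleftrightarrow> 0 < (x :: 'a::linordered_field puiseux)"
  by (simp add: less_puiseux_def)


subsection \<open>Real and imaginary parts\<close>

lift_definition Re_puiseux :: "complex puiseux \<Rightarrow> real puiseux" is "\<lambda>c q. Re (c q)"
  by (rule ramify_ex_pointwise) auto

lift_definition Im_puiseux :: "complex puiseux \<Rightarrow> real puiseux" is "\<lambda>c q. Im (c q)"
  by (rule ramify_ex_pointwise) auto

lift_definition complex_of_puiseux :: "real puiseux \<Rightarrow> complex puiseux" is
  "\<lambda>c q. complex_of_real (c q)"
  by (rule ramify_ex_pointwise) auto

definition i_puiseux :: "complex puiseux" where
  "i_puiseux = puiseux_of 1 (fls_const \<i>)"

lemma cauchy_prod_const: "cauchy_prod (\<lambda>q. if q = 0 then a else 0) c = (\<lambda>q. a * c q)"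
proof
  fix q :: rat
  have "cauchy_prod (\<lambda>q. if q = 0 then a else 0) c q
      = (\<Sum>r\<in>{0}. (if r = 0 then a else 0) * c (q - r))"
    unfolding cauchy_prod_def by (intro sum.mono_neutral_left) auto
  then show "cauchy_prod (\<lambda>q. if q = 0 then a else 0) c q = a * c q" by simp
qed

lemma pcoeff_i_puiseux: "pcoeff i_puiseux = (\<lambda>q. if q = 0 then \<i> else 0)"
  by (auto simp: i_puiseux_def pcoeff_puiseux_of ramify_def fun_eq_iff elim!: Ints_cases)

lemma i_puiseux_square: "i_puiseux * i_puiseux = - 1"
  by (rule puiseux_eqI)
    (simp add: times_puiseux.rep_eq uminus_puiseux.rep_eq one_puiseux.rep_eq pcoeff_i_puiseux cauchy_prod_const)

text \<open>The decomposition \<open>z = a + ib\<close> with \<open>a\<close>, \<open>b\<close> real exists and is unique.\<close>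

lemma Re_Im_puiseux_unique:
  "z = complex_of_puiseux a + i_puiseux * complex_of_puiseux b \<longleftrightarrow>
     a = Re_puiseux z \<and> b = Im_puiseux z"
proof -
  have *: "pcoeff (complex_of_puiseux a + i_puiseux * complex_of_puiseux b) q
      = Complex (pcoeff a q) (pcoeff b q)" for a b q
    by (simp add: plus_puiseux.rep_eq times_puiseux.rep_eq pcoeff_i_puiseux cauchy_prod_const
        complex_of_puiseux.rep_eq complex_eq_iff)
  show ?thesis
    by (auto simp: pcoeff_inject[symmetric] fun_eq_iff * Re_puiseux.rep_eq Im_puiseux.rep_eq complex_eq_iff)
qed


section \<open>Multivariate polynomials\<close>

text \<open>
  The variables are indexed by a finite type \<open>'n\<close>, which plays the role of \<open>[n]\<close>.
  A polynomial is a finitely supported map from exponent vectors to coefficients.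
\<close>

type_synonym ('n, 'a) mpoly = "('n \<Rightarrow>\<^sub>0 nat) \<Rightarrow>\<^sub>0 'a"

definition mpoly_eval :: "('n::finite, 'a::comm_semiring_1) mpoly \<Rightarrow> ('n \<Rightarrow> 'a) \<Rightarrow> 'a" where
  "mpoly_eval f z = (\<Sum>m\<in>Poly_Mapping.keys f. Poly_Mapping.lookup f m * (\<Prod>i\<in>UNIV. z i ^ Poly_Mapping.lookup m i))"

definition multiaffine :: "('n, 'a::zero) mpoly \<Rightarrow> bool" where
  "multiaffine f \<longleftrightarrow> (\<forall>m\<in>Poly_Mapping.keys f. \<forall>i. Poly_Mapping.lookup m i \<le> 1)"

text \<open>The exponent vector of the square-free monomial \<open>x\<^sup>S\<close>.\<close>

definition sqfree_exp :: "'n::finite set \<Rightarrow> 'n \<Rightarrow>\<^sub>0 nat" where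
  "sqfree_exp S = (\<Sum>i\<in>S. Poly_Mapping.single i 1)"

definition stable_mpoly :: "('n::finite, complex puiseux) mpoly \<Rightarrow> bool" where
  "stable_mpoly f \<longleftrightarrow> (\<forall>z. (\<forall>i. Im_puiseux (z i) > 0) \<longrightarrow> mpoly_eval f z \<noteq> 0)"

lemma lookup_sqfree_exp: "Poly_Mapping.lookup (sqfree_exp S) i = (if i \<in> S then 1 else 0)"
proof -
  have "Poly_Mapping.lookup (sqfree_exp S) i = (\<Sum>j\<in>S. if j = i then 1 else 0)"
    by (auto simp: sqfree_exp_def lookup_sum lookup_single when_def intro!: sum.cong)
  then show ?thesis by (simp add: sum.delta)
qed

lemma multiaffine_keys:
  assumes "multiaffine f" "m \<in> Poly_Mapping.keys f"
  shows "m = sqfree_exp {i. Poly_Mapping.lookup m i = 1}"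
proof (rule poly_mapping_eqI)
  fix i
  have "Poly_Mapping.lookup m i \<le> 1" using assms by (simp add: multiaffine_def)
  then show "Poly_Mapping.lookup m i = Poly_Mapping.lookup (sqfree_exp {i. Poly_Mapping.lookup m i = 1}) i"
    by (auto simp: lookup_sqfree_exp)
qed

lemma inj_sqfree_exp: "inj sqfree_exp"
  by (rule injI) (metis lookup_sqfree_exp subsetI subset_antisym zero_neq_one)

lemma mpoly_eval_multiaffine:
  assumes "multiaffine f"
  shows "mpoly_eval f z = (\<Sum>S\<in>UNIV. Poly_Mapping.lookup f (sqfree_exp S) * (\<Prod>i\<in>S. z i))"
proof -
  have "Poly_Mapping.keys f \<subseteq> range sqfree_exp" using multiaffine_keys[OF assms] by blast
  then have "mpoly_eval f z
      = (\<Sum>m\<in>range sqfree_exp. Poly_Mapping.lookup f m * (\<Prod>i\<in>UNIV. z i ^ Poly_Mapping.lookup m i))"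
    unfolding mpoly_eval_def
    by (intro sum.mono_neutral_left) (auto simp: in_keys_iff)
  also have "\<dots> = (\<Sum>S\<in>UNIV. Poly_Mapping.lookup f (sqfree_exp S) * (\<Prod>i\<in>UNIV. z i ^ (if i \<in> S then 1 else 0)))"
    by (subst sum.reindex[OF inj_sqfree_exp]) (simp add: lookup_sqfree_exp)
  also have "\<dots> = (\<Sum>S\<in>UNIV. Poly_Mapping.lookup f (sqfree_exp S) * (\<Prod>i\<in>S. z i))"
  proof (intro sum.cong refl arg_cong2[of _ _ _ _ "(*)"])
    fix S :: "'a set"
    have "(\<Prod>i\<in>UNIV. z i ^ (if i \<in> S then 1 else 0)) = (\<Prod>i\<in>UNIV. if i \<in> S then z i else 1)"
      by (intro prod.cong) auto
    then show "(\<Prod>i\<in>UNIV. z i ^ (if i \<in> S then 1 else 0)) = (\<Prod>i\<in>S. z i)"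
      by (simp add: prod.If_cases)
  qed
  finally show ?thesis .
qed


section \<open>Valuated \<open>\<Delta>\<close>-matroids\<close>

definition delta_matroid :: "'n set set \<Rightarrow> bool" where
  "delta_matroid \<B> \<longleftrightarrow> \<B> \<noteq> {} \<and>
     (\<forall>X\<in>\<B>. \<forall>Y\<in>\<B>. \<forall>i\<in>sym_diff X Y. \<exists>j\<in>sym_diff X Y. sym_diff X {i, j} \<in> \<B>)"

definition ind_vec :: "'n::finite set \<Rightarrow> real ^ 'n" where
  "ind_vec S = (\<chi> i. if i \<in> S then 1 else 0)"

definition delta_matroid_polytope :: "(real ^ 'n::finite) set \<Rightarrow> bool" where
  "delta_matroid_polytope P \<longleftrightarrow> (\<exists>\<B>. delta_matroid \<B> \<and> P = convex hull (ind_vec ` \<B>))"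

text \<open>
  A function \<open>{0,1}\<^sup>n \<rightarrow> \<real> \<union> {\<infinity>}\<close> is given as a function \<open>p\<close> on subsets, with \<open>p S\<close> the value
  at \<open>e\<^sub>S\<close>; the value \<open>-\<infinity>\<close> of the type \<^typ>\<open>ereal\<close> is excluded in \<open>valuated_delta_matroid\<close>.
\<close>

definition min_sets :: "('n::finite set \<Rightarrow> ereal) \<Rightarrow> real ^ 'n \<Rightarrow> 'n set set" where
  "min_sets p w = {S. \<forall>T. ereal (w \<bullet> ind_vec S) + p S \<le> ereal (w \<bullet> ind_vec T) + p T}"

definition regular_subdivision :: "('n::finite set \<Rightarrow> ereal) \<Rightarrow> (real ^ 'n) set set" where
  "regular_subdivision p = {convex hull (ind_vec ` min_sets p w) | w. True}"

definition valuated_delta_matroid :: "('n::finite set \<Rightarrow> ereal) \<Rightarrow> bool" where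
  "valuated_delta_matroid p \<longleftrightarrow>
     (\<forall>S. p S \<noteq> - \<infinity>) \<and> (\<exists>S. p S \<noteq> \<infinity>) \<and>
     (\<forall>P\<in>regular_subdivision p. delta_matroid_polytope P)"

end

theory Submission
  imports Defs
begin

text \<open>
  Let \<open>X\<close>, \<open>Y'\<close> attain the minimum for \<open>w\<close> and let \<open>i \<in> X \<Delta> Y'\<close>.  Among the minimisers \<open>Y\<close> with
  \<open>i \<in> X \<Delta> Y \<subseteq> X \<Delta> Y'\<close> take one with \<open>X \<Delta> Y\<close> as small as possible; the exchange axiom follows once
  \<open>X \<Delta> Y\<close> has at most two elements.  By minimality \<open>w\<close> can be perturbed to a rational \<open>u\<close> for which
  \<open>X\<close> and \<open>Y\<close> are the only minimisers among the sets that agree with them about \<open>i\<close>.  Substituting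
  \<open>z\<^sub>k \<sim> \<zeta>\<^sub>k t\<^bsup>u\<^sub>k\<^esup>\<close> for \<open>k \<noteq> i\<close> and solving \<open>f = 0\<close> for \<open>z\<^sub>i\<close> yields a root whose leading coefficient is
  a monomial in the \<open>\<zeta>\<^sub>k\<close> with \<open>k \<in> X \<Delta> Y - {i}\<close>.  With two such \<open>k\<close> it can be steered into the
  upper half-plane, contradicting stability.
\<close>

section \<open>Leading terms of Puiseux series\<close>

text \<open>The coefficient \<open>a\<close> may be zero, in which case \<open>x\<close> merely has
  valuation above \<open>q\<close>; this lets leading terms be added without a case split on
  cancellation.\<close>

definition leads :: "'a::zero puiseux \<Rightarrow> rat \<Rightarrow> 'a \<Rightarrow> bool" where
  "leads x q a \<longleftrightarrow> (\<forall>r<q. pcoeff x r = 0) \<and> pcoeff x q = a"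

lemma leads_below: "leads x q a \<Longrightarrow> r < q \<Longrightarrow> leads x r 0"
  by (auto simp: leads_def)

lemma leads_0: "leads 0 q 0"
  by (simp add: leads_def zero_puiseux.rep_eq)

lemma leads_1: "leads (1 :: 'a::comm_ring_1 puiseux) 0 1"
  by (simp add: leads_def one_puiseux.rep_eq)

lemma leads_add:
  "leads x q a \<Longrightarrow> leads y q b \<Longrightarrow> leads (x + y :: 'a::comm_ring_1 puiseux) q (a + b)"
  by (simp add: leads_def plus_puiseux.rep_eq)

lemma leads_uminus: "leads x q a \<Longrightarrow> leads (- x :: 'a::comm_ring_1 puiseux) q (- a)"
  by (simp add: leads_def uminus_puiseux.rep_eq)

text \<open>In the Cauchy product at exponent \<open>q + r\<close> only the index \<open>q\<close>
  can contribute; at a smaller exponent no index can.\<close>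

lemma leads_mult:
  fixes x y :: "'a::comm_ring_1 puiseux"
  assumes "leads x q a" "leads y r b"
  shows "leads (x * y) (q + r) (a * b)"
proof -
  have x: "q \<le> s" if "pcoeff x s \<noteq> 0" for s using assms(1) that by (auto simp: leads_def not_less[symmetric])
  have y: "r \<le> s" if "pcoeff y s \<noteq> 0" for s using assms(2) that by (auto simp: leads_def not_less[symmetric])
  have "pcoeff (x * y) s = 0" if "s < q + r" for s
  proof -
    have "{p. pcoeff x p \<noteq> 0 \<and> pcoeff y (s - p) \<noteq> 0} = {}"
      using that x y by fastforce
    then show ?thesis by (simp only: times_puiseux.rep_eq cauchy_prod_def sum.empty)
  qed
  moreover have "pcoeff (x * y) (q + r) = a * b"
  proof -
    have "{p. pcoeff x p \<noteq> 0 \<and> pcoeff y (q + r - p) \<noteq> 0} \<subseteq> {q}"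
      by (auto dest!: x y)
    then have "pcoeff (x * y) (q + r) = (\<Sum>p\<in>{q}. pcoeff x p * pcoeff y (q + r - p))"
      unfolding times_puiseux.rep_eq cauchy_prod_def by (intro sum.mono_neutral_left) auto
    then show ?thesis using assms by (simp add: leads_def)
  qed
  ultimately show ?thesis by (simp add: leads_def)
qed

lemma leads_prod:
  fixes x :: "'i \<Rightarrow> 'a::comm_ring_1 puiseux"
  assumes "finite F" "\<And>k. k \<in> F \<Longrightarrow> leads (x k) (q k) (a k)"
  shows "leads (prod x F) (sum q F) (prod a F)"
  using assms by (induction F rule: finite_induct) (auto simp: leads_1 leads_mult)

lemma leads_sum_dominant:
  fixes x :: "'i \<Rightarrow> 'a::comm_ring_1 puiseux"
  assumes "finite F" "m \<in> F" "leads (x m) q a" "\<And>k. k \<in> F \<Longrightarrow> k \<noteq> m \<Longrightarrow> leads (x k) q 0"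
  shows "leads (sum x F) q a"
proof -
  have "leads (sum x G) q 0" if "finite G" "\<And>k. k \<in> G \<Longrightarrow> leads (x k) q 0" for G
    using that
  proof (induction G rule: finite_induct)
    case (insert k G)
    then show ?case using leads_add[of "x k" q 0 "sum x G" 0] by simp
  qed (simp add: leads_0)
  from this[of "F - {m}"] have "leads (sum x (F - {m})) q 0" using assms by simp
  from leads_add[OF assms(3) this] show ?thesis
    using assms(1,2) by (simp add: sum.remove)
qed

lemma leads_unique:
  assumes "leads x q a" "leads x r b" "a \<noteq> 0" "b \<noteq> 0"
  shows "q = r \<and> a = b"
  using assms by (metis leads_def linorder_neqE)

text \<open>The rationals are not well-ordered, so the \<open>LEAST\<close> in
  \<open>lead_exp\<close> needs an argument: a common denominator \<open>N\<close> reduces it to the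
  subdegree of a Laurent series.\<close>

lemma leads_lead_exp:
  fixes x :: "'a::zero puiseux"
  assumes "x \<noteq> 0"
  shows "leads x (lead_exp x) (pcoeff x (lead_exp x))" "pcoeff x (lead_exp x) \<noteq> 0"
proof -
  obtain N f where Nf: "N \<ge> 1" "x = puiseux_of N f" using puiseux_ex1 by metis
  have f: "f \<noteq> 0" using Nf assms puiseux_of_0 by metis
  show "pcoeff x (lead_exp x) \<noteq> 0"
    using lead_coeff_puiseux_of[OF Nf(1) f] f Nf(2) by simp
  have "pcoeff x r = 0" if "r < lead_exp x" for r
  proof (rule ramify_cases[OF Nf(1), of r])
    fix k assume k: "r = of_int k / of_nat N"
    then have "k < fls_subdegree f"
      using that Nf lead_exp_puiseux_of[OF Nf(1) f] by (simp add: divide_less_cancel)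
    then show ?thesis using k Nf by (simp add: pcoeff_puiseux_of ramify_nth)
  next
    assume "of_nat N * r \<notin> \<int>"
    then show ?thesis using Nf by (simp add: pcoeff_puiseux_of ramify_def)
  qed
  then show "leads x (lead_exp x) (pcoeff x (lead_exp x))" by (simp add: leads_def)
qed

lemma leads_nonzero: "leads x q a \<Longrightarrow> a \<noteq> 0 \<Longrightarrow> x \<noteq> 0"
  by (auto simp: leads_def zero_puiseux.rep_eq)

text \<open>The leading terms of \<open>x\<close> and \<open>inverse x\<close> multiply to that of
  1, which determines both exponent and coefficient.\<close>

lemma leads_inverse:
  fixes x :: "'a::field puiseux"
  assumes "leads x q a" "a \<noteq> 0"
  shows "leads (inverse x) (- q) (inverse a)"
proof -
  have x: "x \<noteq> 0" using leads_nonzero[OF assms] .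
  let ?y = "inverse x"
  have y: "leads ?y (lead_exp ?y) (pcoeff ?y (lead_exp ?y))" "pcoeff ?y (lead_exp ?y) \<noteq> 0"
    using leads_lead_exp[of ?y] x by simp_all
  have "leads (x * ?y) (q + lead_exp ?y) (a * pcoeff ?y (lead_exp ?y))"
    by (rule leads_mult[OF assms(1) y(1)])
  then have "leads 1 (q + lead_exp ?y) (a * pcoeff ?y (lead_exp ?y))" using x by simp
  from leads_unique[OF this leads_1] have "q + lead_exp ?y = 0 \<and> a * pcoeff ?y (lead_exp ?y) = 1"
    using assms(2) y(2) by simp
  then have "lead_exp ?y = - q" "pcoeff ?y (lead_exp ?y) = inverse a"
    by (auto simp: eq_neg_iff_add_eq_0 add.commute dest: inverse_unique)
  then show ?thesis using y(1) by simp
qed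

text \<open>This supplies points with prescribed leading terms; the witness is a monomial, ramified
  by the denominator of \<open>q\<close>.\<close>

lemma leads_exists: "\<exists>x :: 'a::comm_ring_1 puiseux. leads x q a"
proof -
  obtain k n where kn: "q = of_int k / of_int n" "n > 0" by (metis quotient_of_div quotient_of_denom_pos surj_pair)
  define N where "N = nat n"
  have N: "N \<ge> 1" "q = of_int k / of_nat N" using kn by (simp_all add: N_def)
  let ?f = "fls_const a * fls_X_intpow k :: 'a fls"
  have nth: "fls_nth ?f j = (if j = k then a else 0)" for j by simp
  have "leads (puiseux_of N ?f) q a"
    unfolding leads_def
  proof (intro conjI allI impI)
    show "pcoeff (puiseux_of N ?f) q = a"
      by (simp only: pcoeff_puiseux_of[OF N(1)] N(2) ramify_nth[OF N(1)] nth) simp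
    fix r assume r: "r < q"
    show "pcoeff (puiseux_of N ?f) r = 0"
    proof (rule ramify_cases[OF N(1), of r])
      fix j assume j: "r = of_int j / of_nat N"
      then have "j \<noteq> k" using r N by auto
      then show ?thesis by (simp only: pcoeff_puiseux_of[OF N(1)] j ramify_nth[OF N(1)] nth) simp
    next
      assume "of_nat N * r \<notin> \<int>"
      then show ?thesis by (simp add: pcoeff_puiseux_of[OF N(1)] ramify_def)
    qed
  qed
  then show ?thesis by blast
qed

text \<open>The sign of a real series is that of its lowest coefficient, and \<open>Im a\<close>,
  being nonzero, is the lowest coefficient of \<open>Im_puiseux z\<close>.\<close>

lemma leads_Im_pos:
  assumes "leads z q a" "Im a > 0"
  shows "Im_puiseux z > 0"
proof -
  have l: "leads (Im_puiseux z) q (Im a)"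
    using assms(1) by (simp add: leads_def Im_puiseux.rep_eq)
  have nz: "Im_puiseux z \<noteq> 0" using leads_nonzero[OF l] assms(2) by simp
  have "pcoeff (Im_puiseux z) (lead_exp (Im_puiseux z)) = Im a"
    using leads_unique[OF leads_lead_exp(1)[OF nz] l leads_lead_exp(2)[OF nz]] assms(2)
    by (metis less_irrefl)
  then show ?thesis using nz assms(2) by (simp add: puiseux_pos_iff[symmetric] puiseux_pos_def)
qed

section \<open>Steering a root into the upper half-plane\<close>

text \<open>Squaring stretches the open upper half-plane over an angle of \<open>2\<pi>\<close>, so every rotation
  of its image meets the upper half-plane again.\<close>

lemma upper_half_plane_square:
  fixes a :: complex
  assumes "a \<noteq> 0"
  shows "\<exists>s. Im s > 0 \<and> Im (a * s\<^sup>2) > 0"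
proof -
  \<comment> \<open>The square root of \<open>v / a\<close> must be non-real, so
    \<open>v / a\<close> has to avoid the nonnegative real axis. As \<open>1 / a\<close> and
    \<open>\<i> / a\<close> cannot both be real, \<open>\<i>\<close> or \<open>1 + \<i>\<close>
    works.\<close>
  obtain v where v: "Im v > 0" "\<not> (Im (v / a) = 0 \<and> Re (v / a) \<ge> 0)"
  proof (cases "Im (\<i> / a) = 0")
    case True
    have "Im ((1 + \<i>) / a) \<noteq> 0"
    proof
      assume "Im ((1 + \<i>) / a) = 0"
      then have "Im (1 / a) = 0" "Im (\<i> / a) = 0" using True by (simp_all add: add_divide_distrib)
      then have "Im (inverse a) = 0" "Re (inverse a) = 0" by (simp_all add: divide_inverse)
      then show False using assms by (metis complex_eq_iff inverse_nonzero_iff_nonzero zero_complex.simps)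
    qed
    then show ?thesis using that[of "1 + \<i>"] by simp
  qed (use that[of \<i>] in simp)
  define s where "s = csqrt (v / a)"
  have s2: "s\<^sup>2 = v / a" by (simp add: s_def)
  have "Im s \<noteq> 0"
  proof
    assume "Im s = 0"
    then have "s = of_real (Re s)" by (simp add: complex_eq_iff)
    then have "v / a = of_real ((Re s)\<^sup>2)" using s2 by (metis of_real_power)
    then show False using v(2) by simp
  qed
  moreover have "a * s\<^sup>2 = v" "a * (- s)\<^sup>2 = v" using s2 assms by simp_all
  ultimately show ?thesis using v(1)
    by (intro exI[of _ "if Im s > 0 then s else - s"]) auto
qed

text \<open>The coordinates \<open>\<zeta>\<^sub>j\<close>, \<open>\<zeta>\<^sub>l\<close> are taken to be \<open>s\<close> or \<open>-1/s\<close> according to the side of \<open>P \<Delta> Q\<close>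
  containing the index, so that both contribute a factor \<open>\<plusminus>s\<close> to the root \<open>z\<^sub>i = -A/B\<close> of \<open>A + z\<^sub>i B\<close>.\<close>

lemma stable_dominant_pair:
  fixes c :: "'n::finite set \<Rightarrow> complex puiseux" and u :: "'n \<Rightarrow> rat"
  assumes stable: "\<And>z. (\<And>k. Im_puiseux (z k) > 0) \<Longrightarrow> (\<Sum>S\<in>UNIV. c S * prod z S) \<noteq> 0"
    and i: "i \<notin> P" "i \<in> Q" and nz: "c P \<noteq> 0" "c Q \<noteq> 0"
    and P: "\<And>S. i \<notin> S \<Longrightarrow> S \<noteq> P \<Longrightarrow> c S \<noteq> 0 \<Longrightarrow>
      lead_exp (c P) + sum u P < lead_exp (c S) + sum u S"
    and Q: "\<And>S. i \<in> S \<Longrightarrow> S \<noteq> Q \<Longrightarrow> c S \<noteq> 0 \<Longrightarrow>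
      lead_exp (c Q) + sum u Q < lead_exp (c S) + sum u S"
    and j: "j \<in> sym_diff P Q - {i}" "l \<in> sym_diff P Q - {i}"
  shows "j = l"
proof (rule ccontr)
  assume jl: "j \<noteq> l"
  define \<rho> where "\<rho> S = pcoeff (c S) (lead_exp (c S))" for S
  have \<rho>: "leads (c S) (lead_exp (c S)) (\<rho> S)" "\<rho> S \<noteq> 0" if "c S \<noteq> 0" for S
    using leads_lead_exp[OF that] by (simp_all add: \<rho>_def)
  define \<zeta> where "\<zeta> s k = (if k = j \<or> k = l then if k \<in> P then s else - 1 / s else \<i>)" for s k
  define \<phi> where "\<phi> s k = (if k \<in> P then \<zeta> s k else 1) / (if k \<in> Q then \<zeta> s k else 1)" for s k
  define R where "R = UNIV - {i, j, l}"
  define \<sigma> :: "'n \<Rightarrow> complex" where "\<sigma> k = (if k \<in> P then 1 else - 1)" for k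
  \<comment> \<open>Coordinates in \<open>R\<close> do not depend on \<open>s\<close>, so
    \<open>\<phi> 1\<close> replaces \<open>\<phi> s\<close> there and \<open>\<alpha>\<close> is a
    constant. The sign \<open>\<sigma>\<close> arises because \<open>-1/s\<close> in the denominator
    contributes \<open>-s\<close>.\<close>
  define \<alpha> where "\<alpha> = - (\<rho> P / \<rho> Q) * (\<sigma> j * \<sigma> l * prod (\<phi> 1) R)"
  have ratio: "- (\<rho> P * prod (\<zeta> s) P / (\<rho> Q * prod (\<zeta> s) (Q - {i}))) = \<alpha> * s\<^sup>2"
    if "s \<noteq> 0" for s
  proof -
    have "prod (\<zeta> s) P = (\<Prod>k\<in>UNIV - {i}. if k \<in> P then \<zeta> s k else 1)"
      using i by (intro prod.mono_neutral_cong_left) auto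
    moreover have "prod (\<zeta> s) (Q - {i}) = (\<Prod>k\<in>UNIV - {i}. if k \<in> Q then \<zeta> s k else 1)"
      by (intro prod.mono_neutral_cong_left) auto
    ultimately have "prod (\<zeta> s) P / prod (\<zeta> s) (Q - {i}) = prod (\<phi> s) (UNIV - {i})"
      by (simp add: \<phi>_def prod_dividef)
    also have "UNIV - {i} = insert j (insert l R)" using j by (auto simp: R_def)
    also have "prod (\<phi> s) \<dots> = \<phi> s j * (\<phi> s l * prod (\<phi> s) R)"
      using jl by (simp add: R_def)
    also have "prod (\<phi> s) R = prod (\<phi> 1) R"
      by (intro prod.cong) (auto simp: R_def \<phi>_def \<zeta>_def)
    also have "\<phi> s j = \<sigma> j * s" using j that by (auto simp: \<phi>_def \<zeta>_def \<sigma>_def)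
    also have "\<phi> s l = \<sigma> l * s" using j that by (auto simp: \<phi>_def \<zeta>_def \<sigma>_def)
    finally have *: "prod (\<zeta> s) P / prod (\<zeta> s) (Q - {i}) = \<sigma> j * s * (\<sigma> l * s * prod (\<phi> 1) R)" .
    have "- (\<rho> P * prod (\<zeta> s) P / (\<rho> Q * prod (\<zeta> s) (Q - {i})))
        = - (\<rho> P / \<rho> Q) * (prod (\<zeta> s) P / prod (\<zeta> s) (Q - {i}))" by simp
    then show ?thesis unfolding * \<alpha>_def by (simp add: power2_eq_square mult_ac)
  qed
  have "\<alpha> \<noteq> 0"
    using \<rho>(2) nz by (auto simp: \<alpha>_def \<sigma>_def \<phi>_def \<zeta>_def)
  then obtain s where s: "Im s > 0" "Im (\<alpha> * s\<^sup>2) > 0" using upper_half_plane_square by blast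
  have s0: "s \<noteq> 0" using s(1) by auto
  have "Im (- 1 / s) > 0"
    using s(1) by (simp add: Im_divide power2_eq_square add_nonneg_pos)
  then have \<zeta>: "Im (\<zeta> s k) > 0" for k using s(1) by (simp add: \<zeta>_def)
  then have \<zeta>0: "\<zeta> s k \<noteq> 0" for k by (metis less_irrefl zero_complex.simps(2))
  obtain y where y: "\<And>k. leads (y k) (u k) (\<zeta> s k)"
    using choice[of "\<lambda>k x. leads x (u k) (\<zeta> s k)"] leads_exists by blast
  have prod_y: "leads (prod y S) (sum u S) (prod (\<zeta> s) S)" for S
    by (rule leads_prod) (simp_all add: y)
  define A where "A = (\<Sum>S | i \<notin> S. c S * prod y S)"
  define B where "B = (\<Sum>S | i \<in> S. c S * prod y (S - {i}))"
  \<comment> \<open>For \<open>c S = 0\<close> the value \<open>lead_exp (c S)\<close> means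
    nothing, but the zero series has coefficient 0 at every exponent.\<close>
  have dominated: "leads (c S * prod y T) q 0"
    if "c S \<noteq> 0 \<Longrightarrow> q < lead_exp (c S) + sum u T" for S T q
  proof (cases "c S = 0")
    case False
    show ?thesis by (rule leads_below[OF leads_mult[OF \<rho>(1)[OF False] prod_y] that[OF False]])
  qed (simp add: leads_0)
  have A: "leads A (lead_exp (c P) + sum u P) (\<rho> P * prod (\<zeta> s) P)"
    unfolding A_def
  proof (rule leads_sum_dominant[of _ P])
    show "leads (c P * prod y P) (lead_exp (c P) + sum u P) (\<rho> P * prod (\<zeta> s) P)"
      by (intro leads_mult \<rho>(1) nz prod_y)
    show "leads (c S * prod y S) (lead_exp (c P) + sum u P) 0" if "S \<in> {S. i \<notin> S}" "S \<noteq> P" for S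
      using that by (intro dominated P) auto
  qed (use i in auto)
  have B: "leads B (lead_exp (c Q) + sum u (Q - {i})) (\<rho> Q * prod (\<zeta> s) (Q - {i}))"
    unfolding B_def
  proof (rule leads_sum_dominant[of _ Q])
    show "leads (c Q * prod y (Q - {i})) (lead_exp (c Q) + sum u (Q - {i}))
        (\<rho> Q * prod (\<zeta> s) (Q - {i}))"
      by (intro leads_mult \<rho>(1) nz prod_y)
    show "leads (c S * prod y (S - {i})) (lead_exp (c Q) + sum u (Q - {i})) 0"
      if S: "S \<in> {S. i \<in> S}" "S \<noteq> Q" for S
    proof (rule dominated)
      assume "c S \<noteq> 0"
      then have "lead_exp (c Q) + sum u Q < lead_exp (c S) + sum u S" using S by (intro Q) auto
      then show "lead_exp (c Q) + sum u (Q - {i}) < lead_exp (c S) + sum u (S - {i})"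
        using S(1) i(2) by (simp add: sum_diff1)
    qed
  qed (use i in auto)
  have b0: "\<rho> Q * prod (\<zeta> s) (Q - {i}) \<noteq> 0" using \<rho>(2) nz \<zeta>0 by simp
  have B0: "B \<noteq> 0" by (rule leads_nonzero[OF B b0])
  \<comment> \<open>With the other coordinates fixed at \<open>y\<close> the polynomial is
    \<open>A + z i * B\<close>; its root has leading coefficient
    \<open>\<alpha> * s\<^sup>2\<close>, hence positive imaginary part.\<close>
  define z where "z = y(i := - (A * inverse B))"
  have "leads (z i) (lead_exp (c P) + sum u P + - (lead_exp (c Q) + sum u (Q - {i})))
      (- (\<rho> P * prod (\<zeta> s) P * inverse (\<rho> Q * prod (\<zeta> s) (Q - {i}))))"
    unfolding z_def fun_upd_same by (intro leads_uminus leads_mult leads_inverse A B b0)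
  then have "Im_puiseux (z i) > 0"
    by (rule leads_Im_pos) (use ratio[OF s0] s(2) in \<open>simp add: divide_inverse\<close>)
  moreover have "Im_puiseux (y k) > 0" for k by (rule leads_Im_pos[OF y \<zeta>])
  ultimately have "(\<Sum>S\<in>UNIV. c S * prod z S) \<noteq> 0"
    by (intro stable) (simp add: z_def)
  moreover have "(\<Sum>S\<in>UNIV. c S * prod z S) = A + z i * B"
  proof -
    have "(\<Sum>S\<in>UNIV. c S * prod z S) = (\<Sum>S | i \<notin> S. c S * prod z S) + (\<Sum>S | i \<in> S. c S * prod z S)"
      by (subst sum.union_disjoint[symmetric]) (auto intro!: sum.cong)
    also have "(\<Sum>S | i \<notin> S. c S * prod z S) = A"
      unfolding A_def by (intro sum.cong arg_cong2[of _ _ _ _ "(*)"] prod.cong) (auto simp: z_def)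
    also have "(\<Sum>S | i \<in> S. c S * prod z S) = (\<Sum>S | i \<in> S. z i * (c S * prod y (S - {i})))"
    proof (intro sum.cong refl)
      fix S assume "S \<in> {S. i \<in> S}"
      then have "prod z S = z i * prod z (S - {i})" by (simp add: prod.remove)
      also have "prod z (S - {i}) = prod y (S - {i})" by (intro prod.cong) (auto simp: z_def)
      finally show "c S * prod z S = z i * (c S * prod y (S - {i}))" by (simp add: mult_ac)
    qed
    finally show ?thesis by (simp add: B_def sum_distrib_left)
  qed
  moreover have "A + z i * B = 0" using B0 by (simp add: z_def)
  ultimately show False by simp
qed

section \<open>Minimisers and the exchange property\<close>

lemma min_sets_finite:
  assumes "p S0 \<noteq> \<infinity>" "S \<in> min_sets p w"
  shows "p S \<noteq> \<infinity>"
proof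
  assume "p S = \<infinity>"
  moreover have "ereal (w \<bullet> ind_vec S) + p S \<le> ereal (w \<bullet> ind_vec S0) + p S0"
    using assms(2) by (simp add: min_sets_def)
  ultimately show False using assms(1) by (cases "p S0") auto
qed

lemma inner_ind_vec: "w \<bullet> ind_vec S = (\<Sum>k\<in>S. w $ k)"
proof -
  have "w \<bullet> ind_vec S = (\<Sum>k\<in>UNIV. if k \<in> S then w $ k else 0)"
    by (auto simp: inner_vec_def ind_vec_def intro!: sum.cong)
  then show ?thesis by (simp add: sum.If_cases)
qed

lemma min_sets_nonempty: "min_sets p w \<noteq> {}"
proof -
  let ?h = "\<lambda>S. ereal (w \<bullet> ind_vec S) + p S"
  have "Min (range ?h) \<in> range ?h" by (rule Min_in) auto
  then obtain S where "Min (range ?h) = ?h S" by (rule rangeE)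
  moreover have "Min (range ?h) \<le> ?h T" for T by (rule Min_le) auto
  ultimately have "S \<in> min_sets p w" by (simp add: min_sets_def)
  then show ?thesis by blast
qed

lemma stable_exchange:
  fixes c :: "'n::finite set \<Rightarrow> complex puiseux" and w :: "real ^ 'n"
  assumes stable: "\<And>z. (\<And>k. Im_puiseux (z k) > 0) \<Longrightarrow> (\<Sum>S\<in>UNIV. c S * prod z S) \<noteq> 0"
    and nonzero: "c S0 \<noteq> 0"
  defines "M \<equiv> min_sets (\<lambda>S. puiseux_val (c S)) w"
  assumes X: "X \<in> M" and Y': "Y' \<in> M" and i: "i \<in> sym_diff X Y'"
  shows "\<exists>j\<in>sym_diff X Y'. sym_diff X {i, j} \<in> M"
proof -
  define h :: "'n set \<Rightarrow> real" where "h S = of_rat (lead_exp (c S)) + (\<Sum>k\<in>S. w $ k)" for S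
  have val: "ereal (w \<bullet> ind_vec S) + puiseux_val (c S) = ereal (h S)" if "c S \<noteq> 0" for S
    using that by (simp add: puiseux_val_def h_def inner_ind_vec)
  have M_nz: "c S \<noteq> 0" if "S \<in> M" for S
    using min_sets_finite[of "\<lambda>S. puiseux_val (c S)" S0 S w] that nonzero
    by (auto simp: M_def puiseux_val_def)
  have M_le: "h S \<le> h T" if "S \<in> M" "c T \<noteq> 0" for S T
  proof -
    have "ereal (w \<bullet> ind_vec S) + puiseux_val (c S) \<le> ereal (w \<bullet> ind_vec T) + puiseux_val (c T)"
      using that(1) unfolding M_def min_sets_def by blast
    then show ?thesis using val[OF that(2)] val[OF M_nz[OF that(1)]] by simp
  qed
  have M_less: "h X < h S" if "S \<notin> M" "c S \<noteq> 0" for S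
  proof -
    obtain T where T: "ereal (w \<bullet> ind_vec T) + puiseux_val (c T)
        < ereal (w \<bullet> ind_vec S) + puiseux_val (c S)"
      using \<open>S \<notin> M\<close> unfolding M_def min_sets_def by (auto simp: not_le)
    then have "c T \<noteq> 0" by (auto simp: puiseux_val_def)
    then show ?thesis using T val[of T] val[of S] that(2) M_le[OF X, of T] by simp
  qed
  \<comment> \<open>Confining \<open>sym_diff X Y\<close> to \<open>sym_diff X Y'\<close> keeps the
    exchange element found for \<open>Y\<close> valid for \<open>Y'\<close>.\<close>
  define C where "C = {Y\<in>M. i \<in> sym_diff X Y \<and> sym_diff X Y \<subseteq> sym_diff X Y'}"
  have "Y' \<in> C" using Y' i by (simp add: C_def)
  then obtain Y where Y: "Y \<in> C" and Y_min: "\<And>S. S \<in> C \<Longrightarrow> card (sym_diff X Y) \<le> card (sym_diff X S)"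
    using ex_has_least_nat[of "\<lambda>S. S \<in> C" Y' "\<lambda>S. card (sym_diff X S)"] by blast
  define T where "T = sym_diff X Y"
  have YM: "Y \<in> M" and iT: "i \<in> T" and TT: "T \<subseteq> sym_diff X Y'"
    using Y by (simp_all add: C_def T_def)
  \<comment> \<open>Otherwise \<open>S\<close> would compete in \<open>C\<close>, and minimal
    cardinality would force \<open>sym_diff X S = T\<close>, that is \<open>S = Y\<close>.\<close>
  have escape: "\<exists>k\<in>sym_diff X S. k \<notin> T" if "S \<in> M" "i \<in> sym_diff X S" "S \<noteq> Y" for S
  proof (rule ccontr)
    assume "\<not> ?thesis"
    then have sub: "sym_diff X S \<subseteq> T" by blast
    then have "S \<in> C" using that TT by (simp add: C_def) blast
    then have "sym_diff X S = T"
      using sub Y_min card_seteq[of T "sym_diff X S"] by (simp add: T_def)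
    then show False using \<open>S \<noteq> Y\<close> by (auto simp: T_def)
  qed
  define n where "n = real (card (UNIV :: 'n set))"
  have n: "n > 0" by (simp add: n_def card_gt_0_iff)
  \<comment> \<open>\<open>n * \<epsilon>\<close> is chosen as the gap from the minimum to the other
    finite values, capped at 1. Inserting 1 also keeps \<open>Min\<close> off the empty set.\<close>
  obtain \<epsilon> where \<epsilon>: "\<epsilon> > 0" "n * \<epsilon> \<le> 1" "\<And>S. S \<notin> M \<Longrightarrow> c S \<noteq> 0 \<Longrightarrow> h X + n * \<epsilon> \<le> h S"
  proof -
    define E where "E = insert 1 ((\<lambda>S. h S - h X) ` {S. S \<notin> M \<and> c S \<noteq> 0})"
    have "Min E \<in> E" by (rule Min_in) (auto simp: E_def)
    then have "Min E > 0" using M_less by (auto simp: E_def)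
    moreover have "Min E \<le> 1" by (intro Min_le) (auto simp: E_def)
    moreover have "Min E \<le> h S - h X" if "S \<notin> M" "c S \<noteq> 0" for S
      using that by (intro Min_le) (auto simp: E_def)
    ultimately show ?thesis
      using n by (intro that[of "Min E / n"]) (auto simp: E_def le_diff_eq add.commute)
  qed
  define \<sigma> :: "'n \<Rightarrow> real" where "\<sigma> k = (if k \<in> X then - 1 else 1)" for k
  \<comment> \<open>Moving from \<open>X\<close> to \<open>S\<close> costs \<open>d k\<close> (below) for each \<open>k \<in> X \<Delta> S\<close>: little on \<open>T\<close>, prohibitively
    much outside. The exponents must be rational, although \<open>w\<close> is real.\<close>
  have "\<exists>q::rat. 0 < \<sigma> k * (of_rat q - w $ k) \<and>
      (if k \<in> T then \<sigma> k * (of_rat q - w $ k) < \<epsilon> else 1 < \<sigma> k * (of_rat q - w $ k))" for k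
  proof -
    define a b where "a = (if k \<in> T then 0 else 1 :: real)" and "b = (if k \<in> T then \<epsilon> else 2)"
    have ab: "0 \<le> a" "a < b" using \<epsilon>(1) by (auto simp: a_def b_def)
    obtain q :: rat where "a < \<sigma> k * (of_rat q - w $ k)" "\<sigma> k * (of_rat q - w $ k) < b"
    proof (cases "k \<in> X")
      case True
      obtain q where "w $ k - b < of_rat q" "of_rat q < w $ k - a"
        using of_rat_dense[of "w $ k - b" "w $ k - a"] ab by auto
      then show ?thesis using True by (intro that[of q]) (auto simp: \<sigma>_def)
    next
      case False
      obtain q where "w $ k + a < of_rat q" "of_rat q < w $ k + b"
        using of_rat_dense[of "w $ k + a" "w $ k + b"] ab by auto
      then show ?thesis using False by (intro that[of q]) (auto simp: \<sigma>_def)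
    qed
    then show ?thesis using ab(1) by (intro exI[of _ q]) (auto simp: a_def b_def split: if_splits)
  qed
  then obtain u where u: "\<And>k. 0 < \<sigma> k * (of_rat (u k) - w $ k) \<and>
      (if k \<in> T then \<sigma> k * (of_rat (u k) - w $ k) < \<epsilon> else 1 < \<sigma> k * (of_rat (u k) - w $ k))"
    by metis
  define d where "d k = \<sigma> k * (of_rat (u k) - w $ k)" for k
  have d: "d k > 0" "k \<in> T \<Longrightarrow> d k < \<epsilon>" "k \<notin> T \<Longrightarrow> d k > 1" for k
    using u[of k] by (auto simp: d_def split: if_splits)
  define g where "g S = lead_exp (c S) + sum u S" for S
  \<comment> \<open>\<open>g S\<close> is the exponent of the term of \<open>S\<close> after the
    substitution. The signs \<open>\<sigma>\<close> make it, up to a constant, \<open>h S\<close>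
    plus the cost of toggling \<open>sym_diff X S\<close>.\<close>
  have g: "of_rat (g S) = h S + sum d (sym_diff X S) + (\<Sum>k\<in>X. of_rat (u k) - w $ k)" for S
  proof -
    let ?e = "\<lambda>k. of_rat (u k) - w $ k"
    have "sum d (sym_diff X S) = sum d (X - S) + sum d (S - X)"
      by (intro sum.union_disjoint) auto
    also have "sum d (X - S) = - sum ?e (X - S)"
      unfolding sum_negf[symmetric] by (intro sum.cong) (auto simp: d_def \<sigma>_def)
    also have "sum d (S - X) = sum ?e (S - X)"
      by (intro sum.cong) (auto simp: d_def \<sigma>_def)
    also have "sum ?e (X - S) = sum ?e X - sum ?e (X \<inter> S)"
      using sum.Int_Diff[of X ?e S] by simp
    also have "sum ?e (S - X) = sum ?e S - sum ?e (X \<inter> S)"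
      using sum.Int_Diff[of S ?e X] by (simp add: Int_commute)
    finally have "sum d (sym_diff X S) = sum ?e S - sum ?e X" by simp
    then show ?thesis by (simp add: g_def h_def of_rat_add of_rat_sum sum_subtractf)
  qed
  have d_nonneg: "sum d S \<ge> 0" for S using d(1) by (intro sum_nonneg) (simp add: less_imp_le)
  have g_less: "g S < g S'" if "h S + sum d (sym_diff X S) < h S' + sum d (sym_diff X S')" for S S'
  proof -
    have "(of_rat (g S) :: real) < of_rat (g S')" using that by (simp add: g)
    then show ?thesis by (simp add: of_rat_less)
  qed
  have gX: "g X < g S" if "S \<noteq> X" "c S \<noteq> 0" for S
  proof (rule g_less)
    have "sum d (sym_diff X S) > 0" using that d(1) by (intro sum_pos) auto
    then show "h X + sum d (sym_diff X X) < h S + sum d (sym_diff X S)"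
      using M_le[OF X that(2)] by simp
  qed
  \<comment> \<open>Reaching \<open>Y\<close> costs less than \<open>n * \<epsilon>\<close>. A
    competing minimiser must leave \<open>T\<close> and pays more than 1 there; any other competitor
    is already worse by \<open>n * \<epsilon>\<close> in \<open>h\<close>.\<close>
  have gY: "g Y < g S" if S: "i \<in> sym_diff X S" "S \<noteq> Y" "c S \<noteq> 0" for S
  proof (rule g_less)
    have "sum d T < (\<Sum>k\<in>T. \<epsilon>)" using iT d(2) by (intro sum_strict_mono) auto
    also have "\<dots> \<le> n * \<epsilon>" using \<epsilon>(1) by (auto simp: n_def intro!: card_mono mult_right_mono)
    finally have T: "sum d T < n * \<epsilon>" .
    have "h Y = h X" using M_le[of X Y] M_le[of Y X] X YM M_nz by (simp add: order_antisym)
    moreover have "h X + n * \<epsilon> \<le> h S + sum d (sym_diff X S)"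
    proof (cases "S \<in> M")
      case True
      obtain k where k: "k \<in> sym_diff X S" "k \<notin> T" using escape[OF True S(1,2)] by blast
      have "d k \<le> sum d (sym_diff X S)"
        using k(1) d(1) by (intro member_le_sum) (auto simp: less_imp_le)
      then show ?thesis using d(3)[OF k(2)] \<epsilon>(2) M_le[OF X S(3)] by simp
    next
      case False
      then show ?thesis using \<epsilon>(3)[OF False S(3)] d_nonneg[of "sym_diff X S"] by simp
    qed
    ultimately show "h Y + sum d (sym_diff X Y) < h S + sum d (sym_diff X S)"
      using T by (simp add: T_def)
  qed
  have one: "j = l" if jl: "j \<in> T - {i}" "l \<in> T - {i}" for j l
  proof -
    note pair = stable_dominant_pair[of c i]
    have YX: "sym_diff Y X = T" by (auto simp: T_def)
    \<comment> \<open>Whichever of \<open>X\<close> and \<open>Y\<close> lacks \<open>i\<close> has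
      to play the role of \<open>P\<close>.\<close>
    show ?thesis
    proof (cases "i \<in> X")
      case False
      then have "i \<in> Y" using iT by (simp add: T_def)
      show ?thesis
      proof (rule pair[of X Y u j l, folded T_def g_def])
        show "g X < g S" if "S \<noteq> X" "c S \<noteq> 0" for S using that by (rule gX)
        show "g Y < g S" if "i \<in> S" "S \<noteq> Y" "c S \<noteq> 0" for S using that False by (intro gY) auto
      qed (fact stable False \<open>i \<in> Y\<close> M_nz[OF X] M_nz[OF YM] jl)+
    next
      case True
      then have "i \<notin> Y" using iT by (simp add: T_def)
      show ?thesis
      proof (rule pair[of Y X u j l, unfolded YX, folded g_def])
        show "g X < g S" if "S \<noteq> X" "c S \<noteq> 0" for S using that by (rule gX)
        show "g Y < g S" if "i \<notin> S" "S \<noteq> Y" "c S \<noteq> 0" for S using that True by (intro gY) auto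
      qed (fact stable True \<open>i \<notin> Y\<close> M_nz[OF X] M_nz[OF YM] jl)+
    qed
  qed
  \<comment> \<open>If \<open>T\<close> is \<open>{i}\<close>, the exchange element is
    \<open>i\<close> itself.\<close>
  obtain j where j: "j \<in> T" "T = {i, j}"
  proof (cases "T - {i} = {}")
    case True
    then show ?thesis using iT that[of i] by auto
  next
    case False
    then obtain j where "j \<in> T - {i}" by blast
    then show ?thesis using iT one that[of j] by blast
  qed
  have "sym_diff X {i, j} = Y" unfolding j(2)[symmetric] T_def by blast
  then show ?thesis using j(1) TT YM by blast
qed

theorem theorem4p1:
  fixes f :: "('n::finite, complex puiseux) mpoly"
  assumes "multiaffine f" and "stable_mpoly f"
  shows "valuated_delta_matroid (\<lambda>S. puiseux_val (Poly_Mapping.lookup f (sqfree_exp S)))"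
proof -
  define c where "c S = Poly_Mapping.lookup f (sqfree_exp S)" for S
  have stable: "(\<Sum>S\<in>UNIV. c S * prod z S) \<noteq> 0" if "\<And>k. Im_puiseux (z k) > 0" for z
    using that assms(2) unfolding c_def mpoly_eval_multiaffine[OF assms(1), symmetric]
    by (simp add: stable_mpoly_def)
  \<comment> \<open>Stability at one point of the upper half-plane rules out the zero polynomial, so
    the valuations are not all infinite.\<close>
  obtain y :: "complex puiseux" where "leads y 0 \<i>" using leads_exists by blast
  then have "Im_puiseux y > 0" by (rule leads_Im_pos) simp
  then have "(\<Sum>S\<in>UNIV. c S * prod (\<lambda>_. y) S) \<noteq> 0" by (intro stable)
  then obtain S0 where S0: "c S0 \<noteq> 0" by (metis (mono_tags, lifting) mult_zero_left sum.neutral)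
  \<comment> \<open>For each cell the minimisers themselves serve as the \<Delta>-matroid whose hull
    it is.\<close>
  have "delta_matroid (min_sets (\<lambda>S. puiseux_val (c S)) w)" for w
    unfolding delta_matroid_def using min_sets_nonempty stable_exchange[of c, OF stable S0] by blast
  moreover have "puiseux_val (c S) \<noteq> - \<infinity>" for S by (simp add: puiseux_val_def)
  moreover have "puiseux_val (c S0) \<noteq> \<infinity>" using S0 by (simp add: puiseux_val_def)
  ultimately show ?thesis
    unfolding c_def[symmetric] valuated_delta_matroid_def regular_subdivision_def
      delta_matroid_polytope_def by blast
qed

end
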